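(* For any integers $k\geq 1$ and $m\geq 2$, the graph $C_{4k}\times P_m$ admits a $4(2m-1)$-divisible graceful $\alpha$-labeling.
   Context: $C_n$ ($n\ge 3$) is the cycle on $n$ vertices and $P_m$ ($m\ge 2$) is the path on $m$ vertices. $C_n\times P_m$ denotes their Cartesian product (the grid on a cylinder): its vertices are the pairs $(i,j)$ with $1\le i\le m$, $1\le j\le n$, and its edges are $[(i,j),(i,j+1)]$ (with $j$ taken modulo $n$) for $1\le i\le m$, and $[(i,j),(i+1,j)]$ for $1\le i\le m-1$. The graph $C_{4k}\times P_m$ is bipartite and has $4k(2m-1)$ edges. The size of a graph is its number of edges. Let $\Gamma$ be a graph of size $e=d\cdot q$ with $d,q$ positive integers. A $d$-divisible graceful labeling of $\Gamma$ is an injective function $f:V(\Gamma)\to\{0,1,2,\ldots,d(q+1)-1\}$ such that $$\{|f(x)-f(y)| : [x,y]\in E(\Gamma)\}=\{1,2,3,\ldots,d(q+1)\}\setminus\{q+1,2(q+1),\ldots,d(q+1)\}.$$ If $\Gamma$ is bipartite, a $d$-divisible graceful $\alpha$-labeling of $\Gamma$ is a $d$-divisible graceful labeling $f$ of $\Gamma$ such that the maximum value of $f$ on one of the two bipartite sets is strictly less than its minimum value on the other one. *)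

theory Defs
  imports Main
begin

text \<open>Graphs are finite and simple, given by a vertex set and a set of two-element edge sets.\<close>

definition simple_graph :: "'a set \<Rightarrow> 'a set set \<Rightarrow> bool" where
  "simple_graph V E \<longleftrightarrow> finite V \<and> (\<forall>e\<in>E. e \<subseteq> V \<and> card e = 2)"

definition bipartition :: "'a set \<Rightarrow> 'a set set \<Rightarrow> 'a set \<Rightarrow> 'a set \<Rightarrow> bool" where
  "bipartition V E A B \<longleftrightarrow>
     A \<noteq> {} \<and> B \<noteq> {} \<and> A \<union> B = V \<and> A \<inter> B = {} \<and> (\<forall>e\<in>E. \<exists>a\<in>A. \<exists>b\<in>B. e = {a, b})"

text \<open>Since \<open>d > 0\<close>, the quotient \<open>q\<close> is determined by \<open>d\<close> and the size of the graph.\<close>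

definition divisible_graceful_labeling ::
    "nat \<Rightarrow> 'a set \<Rightarrow> 'a set set \<Rightarrow> ('a \<Rightarrow> nat) \<Rightarrow> bool" where
  "divisible_graceful_labeling d V E f \<longleftrightarrow>
     simple_graph V E \<and>
     (\<exists>q. d > 0 \<and> q > 0 \<and> card E = d * q \<and>
        inj_on f V \<and> f ` V \<subseteq> {0..d * (q + 1) - 1} \<and>
        {\<bar>int (f x) - int (f y)\<bar> | x y. {x, y} \<in> E} =
          int ` ({1..d * (q + 1)} - {i * (q + 1) | i. i \<in> {1..d}}))"

text \<open>The two sides of a bipartition may be swapped, so \<open>A\<close> is the side with the smaller labels
  without loss of generality.\<close>

definition divisible_graceful_alpha_labeling ::
    "nat \<Rightarrow> 'a set \<Rightarrow> 'a set set \<Rightarrow> ('a \<Rightarrow> nat) \<Rightarrow> bool" where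
  "divisible_graceful_alpha_labeling d V E f \<longleftrightarrow>
     divisible_graceful_labeling d V E f \<and>
     (\<exists>A B. bipartition V E A B \<and> Max (f ` A) < Min (f ` B))"

text \<open>The Cartesian product of the cycle on \<open>n\<close> vertices and the path on \<open>m\<close> vertices; a vertex
  \<open>(i, j)\<close> has path coordinate \<open>i\<close> and cycle coordinate \<open>j\<close>. The successor of \<open>j\<close> in the cycle
  \<open>1, \<dots>, n\<close> is \<open>j mod n + 1\<close>.\<close>

definition cylinder_verts :: "nat \<Rightarrow> nat \<Rightarrow> (nat \<times> nat) set" where
  "cylinder_verts n m = {1..m} \<times> {1..n}"

definition cylinder_edges :: "nat \<Rightarrow> nat \<Rightarrow> (nat \<times> nat) set set" where
  "cylinder_edges n m =
     {{(i, j), (i, j mod n + 1)} | i j. i \<in> {1..m} \<and> j \<in> {1..n}} \<union>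
     {{(i, j), (i + 1, j)} | i j. i \<in> {1..m - 1} \<and> j \<in> {1..n}}"

lemma simple_graph_cylinder:
  assumes "n \<ge> 3"
  shows "simple_graph (cylinder_verts n m) (cylinder_edges n m)"
proof -
  have "j mod n + 1 \<noteq> j \<and> j mod n + 1 \<in> {1..n}" if "j \<in> {1..n}" for j
    using that assms by (cases "j = n") auto
  then show ?thesis
    unfolding simple_graph_def cylinder_verts_def cylinder_edges_def
    by (fastforce simp: card_2_iff)
qed

lemma card_cylinder_edges:
  assumes "n \<ge> 3" "m \<ge> 1"
  shows "card (cylinder_edges n m) = n * (2 * m - 1)"
proof -
  let ?h = "\<lambda>(i, j). {(i, j), (i, j mod n + 1)} :: (nat \<times> nat) set"
  let ?v = "\<lambda>(i, j). {(i, j), (i + 1, j)} :: (nat \<times> nat) set"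
  let ?H = "{1..m} \<times> {1..n}" and ?V = "{1..m - 1} \<times> {1..n}"
  have split: "cylinder_edges n m = ?h ` ?H \<union> ?v ` ?V"
    unfolding cylinder_edges_def
    by (intro arg_cong2[where f = "(\<union>)"]; fastforce simp: image_def)
  have suc: "j mod n + 1 = (if j = n then 1 else j + 1)" if "j \<in> {1..n}" for j
    using that by auto
  have "inj_on ?h ?H"
  proof (rule inj_onI, clarify)
    fix i j i' j' assume *: "i \<in> {1..m}" "j \<in> {1..n}" "i' \<in> {1..m}" "j' \<in> {1..n}"
      and eq: "{(i, j), (i, j mod n + 1)} = {(i', j'), (i', j' mod n + 1)}"
    show "i = i' \<and> j = j'"
      using eq * assms unfolding suc[OF *(2)] suc[OF *(4)]
      by (auto simp: doubleton_eq_iff split: if_splits)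
  qed
  moreover have "inj_on ?v ?V"
    by (auto simp: inj_on_def doubleton_eq_iff)
  moreover have "?h ` ?H \<inter> ?v ` ?V = {}"
    by (auto simp: doubleton_eq_iff)
  ultimately have "card (cylinder_edges n m) = card ?H + card ?V"
    unfolding split by (subst card_Un_disjoint) (auto simp: card_image)
  also have "\<dots> = n * (2 * m - 1)"
    using assms(2) by (cases m) (auto simp: algebra_simps)
  finally show ?thesis .
qed

end

theory Submission imports Defs begin

text \<open>A \<open>c\<close>-divisible graceful \<open>\<alpha>\<close>-labeling \<open>g\<close> of a cycle propagates along the path: each layer
  is a copy of the previous one, rotated by one step, with its small labels raised and its large
  labels lowered by \<open>M = c (q + 1)\<close>. By the rotation, the edges joining two consecutive layers
  repeat the differences of the cycle shifted by an odd multiple of \<open>M\<close>, while the edges inside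
  the layers give the even multiples. It then suffices to label \<open>C\<^sub>4\<^sub>k\<close>, for which the usual zigzag
  \<open>0, N, 1, N - 1, \<dots>\<close> with \<open>N = 4k + 3\<close> works, with jumps that skip the multiples of \<open>k + 1\<close> and
  the difference \<open>2k + 3\<close> left to the closing edge.\<close>

section \<open>Rotations of the cycle modulo \<open>n\<close>\<close>

lemma ex_shift_mod_eq:
  fixes p n :: nat
  assumes "p < n"
  shows "\<exists>j\<in>{1..n}. (i + j) mod n = p"
proof -
  \<comment> \<open>\<open>r\<close> is the residue of i - p, with \<open>n\<close> added so that
    nothing truncates; the witness \<open>n - r\<close> then lies in \<open>{1..n}\<close>.\<close>
  define r where "r = (i + (n - p)) mod n"
  have "r < n" using assms by (simp add: r_def)
  have "i + (n - p) = r + n * ((i + (n - p)) div n)"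
    by (simp add: r_def)
  then have "i + (n - r) = p + n * ((i + (n - p)) div n)"
    using assms \<open>r < n\<close> by linarith
  then have "(i + (n - r)) mod n = p"
    using assms by simp
  moreover have "n - r \<in> {1..n}" using \<open>r < n\<close> by auto
  ultimately show ?thesis by blast
qed

lemma shift_mod_inj:
  fixes j j' n :: nat
  assumes "(i + j) mod n = (i + j') mod n" "j \<in> {1..n}" "j' \<in> {1..n}"
  shows "j = j'"
  using assms
proof (induction j j' rule: linorder_wlog)
  case (le j j')
  then have "n dvd j' - j"
    using mod_eq_dvd_iff_nat[of "i + j" "i + j'" n] by simp
  moreover have "j' - j < n" using le by auto
  ultimately have "j' - j = 0" by (metis gr0I nat_dvd_not_less)
  with le show ?case by simp
qed simp

section \<open>Propagating a cycle labeling along the path\<close>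

text \<open>With this index \<open>p\<close>, a step along the path and a step around the cycle both
  lead to the successor of \<open>p\<close>. For \<open>i\<close> in \<open>{1..m}\<close> no
  subtraction truncates: \<open>i - 1\<close> runs up from 0 to \<open>m - 1\<close>, and
  \<open>2 * m - 1 - i\<close> down from \<open>2 * m - 2\<close> to \<open>m - 1\<close>.\<close>

definition cylinder_label :: "(nat \<Rightarrow> nat) \<Rightarrow> nat \<Rightarrow> nat \<Rightarrow> nat \<Rightarrow> nat \<times> nat \<Rightarrow> nat" where
  "cylinder_label g n M m = (\<lambda>(i, j). let p = (i + j) mod n in
     if even p then g p + M * (i - 1) else g p + M * (2 * m - 1 - i))"

text \<open>Serves both kinds of edges: \<open>i' = i\<close> inside a layer,
  \<open>i' = i + 1\<close> between two layers. As \<open>n\<close> is even, the successor modulo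
  \<open>n\<close> changes parity even when it wraps around; the endpoint of odd index thus carries
  the larger label, and the absolute values open with a known sign.\<close>

lemma cylinder_label_diff:
  fixes g :: "nat \<Rightarrow> nat"
  assumes n: "even n" "n > 0" and i: "i \<in> {1..m}" "i' \<in> {i, i + 1}" "i' \<le> m"
    and succ: "(i' + j') mod n = Suc (i + j) mod n"
    and p: "p = (i + j) mod n"
    and low: "\<And>p. p < n \<Longrightarrow> even p \<Longrightarrow> g p < b"
    and high: "\<And>p. p < n \<Longrightarrow> odd p \<Longrightarrow> b \<le> g p"
  shows "\<bar>int (cylinder_label g n M m (i, j)) - int (cylinder_label g n M m (i', j'))\<bar>
    = \<bar>int (g p) - int (g (Suc p mod n))\<bar> + int (M * (2 * m - i - i'))"
proof -
  define p' where "p' = Suc p mod n"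
  have p': "(i' + j') mod n = p'" using succ p by (simp add: p'_def mod_Suc_eq)
  have par: "even p' \<longleftrightarrow> odd p"
    unfolding p'_def using n by (simp add: dvd_mod_iff)
  have lt: "p < n" "p' < n" using n by (simp_all add: p p'_def)
  \<comment> \<open>Whichever endpoint is the large one, its shift exceeds that of the other by the
    same amount; \<open>i + i' \<le> 2 * m\<close> keeps the subtractions exact.\<close>
  have sum: "M * (2 * m - 1 - i) = M * (2 * m - i - i') + M * (i' - 1)"
    "M * (2 * m - 1 - i') = M * (2 * m - i - i') + M * (i - 1)"
    using i by (auto simp flip: distrib_left)
  show ?thesis
  proof (cases "even p")
    case True
    then have "g p < g p'" using low[of p] high[of p'] par lt by force
    moreover have "cylinder_label g n M m (i, j) = g p + M * (i - 1)"
      using True by (simp add: cylinder_label_def p)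
    moreover have "cylinder_label g n M m (i', j') = g p' + M * (2 * m - 1 - i')"
      using True par by (simp add: cylinder_label_def p' Let_def)
    ultimately show ?thesis unfolding p'_def[symmetric] sum by linarith
  next
    case False
    then have "g p' < g p" using low[of p'] high[of p] par lt by force
    moreover have "cylinder_label g n M m (i, j) = g p + M * (2 * m - 1 - i)"
      using False by (simp add: cylinder_label_def p Let_def)
    moreover have "cylinder_label g n M m (i', j') = g p' + M * (i' - 1)"
      using False par by (simp add: cylinder_label_def p')
    ultimately show ?thesis unfolding p'_def[symmetric] sum by linarith
  qed
qed

text \<open>Each \<open>s < 2 * m - 1\<close> occurs as the shift of one full copy of the cycle
  differences, inside a layer for even \<open>s\<close> and between layers for odd \<open>s\<close>.
  As \<open>q + 1\<close> divides \<open>c * (q + 1)\<close>, these copies tile the non-multiples of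
  \<open>q + 1\<close> below \<open>c * (q + 1) * (2 * m - 1)\<close>.\<close>

lemma cylinder_divisible_alpha:
  fixes g :: "nat \<Rightarrow> nat"
  assumes n: "n = c * q" "even n" "n \<ge> 3" and m: "m \<ge> 1"
    and inj: "inj_on g {..<n}"
    and low: "\<And>p. p < n \<Longrightarrow> even p \<Longrightarrow> g p < b"
    and high: "\<And>p. p < n \<Longrightarrow> odd p \<Longrightarrow> b \<le> g p \<and> g p < c * (q + 1)"
    and diff: "(\<lambda>p. \<bar>int (g p) - int (g (Suc p mod n))\<bar>) ` {..<n}
      = int ` {r. r < c * (q + 1) \<and> \<not> q + 1 dvd r}"
  shows "divisible_graceful_alpha_labeling (c * (2 * m - 1))
    (cylinder_verts n m) (cylinder_edges n m) (cylinder_label g n (c * (q + 1)) m)"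
proof -
  define M where "M = c * (q + 1)"
  define f where "f = cylinder_label g n M m"
  let ?V = "cylinder_verts n m" and ?E = "cylinder_edges n m"
  let ?\<delta> = "\<lambda>p. \<bar>int (g p) - int (g (Suc p mod n))\<bar>"
  have pos: "c > 0" "q > 0" "M > 0" using n unfolding M_def by (auto intro!: Nat.gr0I)
  have "b \<le> M" using high[of 1] n unfolding M_def by force
  have gM: "g p < M" if "p < n" for p
    using low[of p] high[of p] that \<open>b \<le> M\<close> unfolding M_def by (cases "even p") auto
  have fE: "f (i, j) = g ((i + j) mod n) + M * (i - 1)" if "even ((i + j) mod n)" for i j
    using that by (simp add: f_def cylinder_label_def)
  have fO: "f (i, j) = g ((i + j) mod n) + M * (2 * m - 1 - i)" if "odd ((i + j) mod n)" for i j
    using that by (simp add: f_def cylinder_label_def Let_def)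
  have mn: "(i + j) mod n < n" for i j using n(3) by simp
  \<comment> \<open>The threshold \<open>b + M * (m - 1)\<close> separates the two classes: small
    labels are raised by at most \<open>M * (m - 1)\<close>, large ones by at least that
    much.\<close>
  have lowf: "f (i, j) < b + M * (m - 1)" if "even ((i + j) mod n)" "i \<in> {1..m}" for i j
  proof -
    have "M * (i - 1) \<le> M * (m - 1)" using that by (auto intro: diff_le_mono)
    then show ?thesis using fE[OF that(1)] low[OF mn that(1)] by linarith
  qed
  have highf: "b + M * (m - 1) \<le> f (i, j)" if "odd ((i + j) mod n)" "i \<in> {1..m}" for i j
  proof -
    have "M * (m - 1) \<le> M * (2 * m - 1 - i)" using that by (intro mult_le_mono2) auto
    then show ?thesis using fO[OF that(1)] high[OF mn that(1)] by linarith
  qed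
  have injf: "inj_on f ?V"
  proof (rule inj_onI, clarify)
    fix i j i' j'
    assume "(i, j) \<in> ?V" "(i', j') \<in> ?V" and eq: "f (i, j) = f (i', j')"
    then have V: "i \<in> {1..m}" "j \<in> {1..n}" "i' \<in> {1..m}" "j' \<in> {1..n}"
      by (auto simp: cylinder_verts_def)
    define p p' where "p = (i + j) mod n" and "p' = (i' + j') mod n"
    have lt: "p < n" "p' < n" using mn by (simp_all add: p_def p'_def)
    \<comment> \<open>Division by \<open>M\<close> recovers the cycle label as remainder and the
      layer from the quotient, once the parity class is known.\<close>
    have *: "x = y \<and> s = t" if "x + M * s = y + M * t" "x < M" "y < M" for x y s t
    proof -
      have "(x + M * s) mod M = x" "(y + M * t) mod M = y" using that(2,3) by auto
    then have "x = y" unfolding that(1) by simp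
      with that pos show ?thesis by simp
    qed
    have par: "even p = even p'"
      using lowf[of i j] highf[of i j] lowf[of i' j'] highf[of i' j'] V eq
      unfolding p_def p'_def by force
    have "g p = g p' \<and> i = i'"
    proof (cases "even p")
      case True
      then have "g p + M * (i - 1) = g p' + M * (i' - 1)"
        using par eq fE[of i j] fE[of i' j'] by (simp add: p_def p'_def)
      from *[OF this gM gM] lt V show ?thesis by auto
    next
      case False
      then have "g p + M * (2 * m - 1 - i) = g p' + M * (2 * m - 1 - i')"
        using par eq fO[of i j] fO[of i' j'] by (simp add: p_def p'_def)
      from *[OF this gM gM] lt V show ?thesis by auto
    qed
    then have "p = p'" "i = i'" using inj lt by (auto simp: inj_on_def)
    with shift_mod_inj[of i j n j'] V show "i = i' \<and> j = j'" by (simp add: p_def p'_def)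
  qed
  have top: "f x < M * (2 * m - 1)" if "x \<in> ?V" for x
  proof -
    obtain i j where x: "x = (i, j)" "i \<in> {1..m}" using \<open>x \<in> ?V\<close> unfolding cylinder_verts_def by blast
    have "\<exists>s. f x = g ((i + j) mod n) + M * s \<and> s \<le> 2 * m - 2"
    proof (cases "even ((i + j) mod n)")
      case True
      then show ?thesis using fE x by (intro exI[of _ "i - 1"]) auto
    next
      case False
      then show ?thesis using fO x by (intro exI[of _ "2 * m - 1 - i"]) auto
    qed
    then obtain s where s: "f x = g ((i + j) mod n) + M * s" "s \<le> 2 * m - 2" by blast
    have "f x < M * Suc s" using s gM[OF mn] by simp
    also have "\<dots> \<le> M * (2 * m - 1)" using s m by (intro mult_le_mono2) linarith
    finally show ?thesis .
  qed
  have dh: "\<bar>int (f (i, j)) - int (f (i, j mod n + 1))\<bar>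
      = ?\<delta> ((i + j) mod n) + int (M * (2 * m - 2 * i))" if "i \<in> {1..m}" for i j
  proof -
    have "(i + (j mod n + 1)) mod n = Suc (i + j) mod n" using mod_add_right_eq[of "Suc i" j n] by simp
    then have "\<bar>int (f (i, j)) - int (f (i, j mod n + 1))\<bar>
      = ?\<delta> ((i + j) mod n) + int (M * (2 * m - i - i))"
      unfolding f_def using that n(2,3)
      by (intro cylinder_label_diff[where b = b and m = m] low conjunct1[OF high]) simp_all
    then show ?thesis by (simp add: mult_2)
  qed
  have dv: "\<bar>int (f (i, j)) - int (f (i + 1, j))\<bar>
      = ?\<delta> ((i + j) mod n) + int (M * (2 * m - 1 - 2 * i))" if "i \<in> {1..m - 1}" for i j
  proof -
    have "\<bar>int (f (i, j)) - int (f (i + 1, j))\<bar>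
      = ?\<delta> ((i + j) mod n) + int (M * (2 * m - i - (i + 1)))"
      unfolding f_def using that n(2,3)
      by (intro cylinder_label_diff[where b = b and m = m] low conjunct1[OF high]) auto
    moreover have "2 * m - i - (i + 1) = 2 * m - 1 - 2 * i" by simp
    ultimately show ?thesis by simp
  qed
  have MU: "M * (2 * m - 1) = c * (2 * m - 1) * (q + 1)"
    unfolding M_def by (simp only: ac_simps)
  have diffs: "{\<bar>int (f x) - int (f y)\<bar> | x y. {x, y} \<in> ?E}
    = {?\<delta> p + int (M * s) | p s. p < n \<and> s < 2 * m - 1}" (is "?L = ?R")
  proof (intro equalityI subsetI)
    fix z assume "z \<in> ?L"
    then obtain x y where z: "z = \<bar>int (f x) - int (f y)\<bar>" and "{x, y} \<in> ?E" by blast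
    then consider i j where "i \<in> {1..m}" "{x, y} = {(i, j), (i, j mod n + 1)}"
      | i j where "i \<in> {1..m - 1}" "{x, y} = {(i, j), (i + 1, j)}"
      unfolding cylinder_edges_def by blast
    then show "z \<in> ?R"
    proof cases
      case 1
      then have "z = \<bar>int (f (i, j)) - int (f (i, j mod n + 1))\<bar>"
        using z by (auto simp: doubleton_eq_iff abs_minus_commute)
      moreover have "2 * m - 2 * i < 2 * m - 1" using 1 by auto
      ultimately show ?thesis using dh[OF 1(1)] mn by blast
    next
      case 2
      then have "z = \<bar>int (f (i, j)) - int (f (i + 1, j))\<bar>"
        using z by (auto simp: doubleton_eq_iff abs_minus_commute)
      moreover have "2 * m - 1 - 2 * i < 2 * m - 1" using 2 by auto
      ultimately show ?thesis using dv[OF 2(1)] mn by blast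
    qed
  next
    fix z assume "z \<in> ?R"
    then obtain p s where z: "z = ?\<delta> p + int (M * s)" and "p < n" and s: "s < 2 * m - 1" by blast
    \<comment> \<open>Solves \<open>s = 2 * m - 2 * i\<close> for even \<open>s\<close> and
      \<open>s = 2 * m - 1 - 2 * i\<close> for odd \<open>s\<close> at once.\<close>
    define i where "i = m - (s + 1) div 2"
    obtain j where j: "j \<in> {1..n}" "(i + j) mod n = p"
      using ex_shift_mod_eq[OF \<open>p < n\<close>] by blast
    show "z \<in> ?L"
    proof (cases "even s")
      case True
      then have i: "i \<in> {1..m}" "2 * m - 2 * i = s" using s by (auto simp: i_def elim!: evenE)
      then have "{(i, j), (i, j mod n + 1)} \<in> ?E" using j by (auto simp: cylinder_edges_def)
      moreover have "z = \<bar>int (f (i, j)) - int (f (i, j mod n + 1))\<bar>"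
        unfolding dh[OF i(1)] i(2) j(2) z ..
      ultimately show ?thesis by blast
    next
      case False
      then have i: "i \<in> {1..m - 1}" "2 * m - 1 - 2 * i = s" using s by (auto simp: i_def elim!: oddE)
      then have "{(i, j), (i + 1, j)} \<in> ?E" using j unfolding cylinder_edges_def by blast
      moreover have "z = \<bar>int (f (i, j)) - int (f (i + 1, j))\<bar>"
        unfolding dv[OF i(1)] i(2) j(2) z ..
      ultimately show ?thesis by blast
    qed
  qed
  have "?R = {int r + int (M * s) | r s. r < M \<and> \<not> q + 1 dvd r \<and> s < 2 * m - 1}"
  proof -
    have "?R = {a + int (M * s) | a s. a \<in> ?\<delta> ` {..<n} \<and> s < 2 * m - 1}" by blast
    then show ?thesis unfolding diff M_def[symmetric] by blast
  qed
  \<comment> \<open>Here \<open>r\<close> and \<open>s\<close> are remainder and quotient of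
    \<open>x\<close> by \<open>M\<close>; since \<open>q + 1\<close> divides \<open>M\<close>,
    divisibility of \<open>x\<close> depends on \<open>r\<close> alone.\<close>
  also have "\<dots> = int ` {x. x < M * (2 * m - 1) \<and> \<not> q + 1 dvd x}" (is "?S = int ` ?T")
  proof (intro equalityI subsetI)
    fix z assume "z \<in> ?S"
    then obtain r s where z: "z = int (r + M * s)" and r: "r < M" "\<not> q + 1 dvd r" "s < 2 * m - 1"
      by auto
    have "r + M * s < M * Suc s" using r by simp
    also have "\<dots> \<le> M * (2 * m - 1)" using r by (intro mult_le_mono2) linarith
    finally have "r + M * s < M * (2 * m - 1)" .
    moreover have "q + 1 dvd M * s" by (simp only: M_def dvd_mult dvd_mult2 dvd_refl)
    then have "\<not> q + 1 dvd r + M * s" using r(2) by (simp only: dvd_add_left_iff not_False_eq_True)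
    ultimately show "z \<in> int ` ?T" unfolding z by blast
  next
    fix z assume "z \<in> int ` ?T"
    then obtain x where x: "z = int x" "x < M * (2 * m - 1)" "\<not> q + 1 dvd x" by blast
    have "q + 1 dvd M" unfolding M_def by (rule dvd_triv_right)
    then have "\<not> q + 1 dvd x mod M" using x(3) dvd_mod_iff[of "q + 1" M x] by blast
    moreover have "x div M < 2 * m - 1" using x(2) by (simp add: less_mult_imp_div_less mult.commute)
    moreover have "z = int (x mod M) + int (M * (x div M))"
      using x(1) by (simp flip: of_nat_add of_nat_mult)
    ultimately show "z \<in> ?S"
      using mod_less_divisor[OF pos(3), of x] by blast
  qed
  also have "?T = {1..c * (2 * m - 1) * (q + 1)} - {i * (q + 1) | i. i \<in> {1..c * (2 * m - 1)}}"
    (is "_ = ?U - ?W")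
  proof -
    show ?thesis
    proof (intro equalityI subsetI)
      fix x assume "x \<in> ?T"
      then have "x < c * (2 * m - 1) * (q + 1)" "\<not> q + 1 dvd x" unfolding MU by auto
      moreover from this(2) have "x \<noteq> 0" by (cases "x = 0") auto
      moreover have "x \<noteq> i * (q + 1)" for i
        using \<open>\<not> q + 1 dvd x\<close> dvd_triv_right[of "q + 1" i] by blast
      ultimately have "x \<in> ?U" "x \<notin> ?W" by simp_all
      then show "x \<in> ?U - ?W" by blast
    next
      fix x assume x: "x \<in> ?U - ?W"
      have "\<not> q + 1 dvd x"
      proof
        assume "q + 1 dvd x"
        then obtain t where t: "x = t * (q + 1)" by (metis dvd_def mult.commute)
        then have "t \<in> {1..c * (2 * m - 1)}"
          using x mult_le_cancel2[of t "q + 1" "c * (2 * m - 1)"] by (cases "t = 0") auto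
        with x t show False by blast
      qed
      \<comment> \<open>The right end of \<open>?U\<close> is itself a multiple of
        \<open>q + 1\<close>, which reconciles its closed range with the strict bound in
        \<open>?T\<close>.\<close>
      moreover have "x \<noteq> c * (2 * m - 1) * (q + 1)"
        using calculation by (metis dvd_triv_right)
      ultimately show "x \<in> ?T" using x unfolding MU by auto
    qed
  qed
  finally have labels: "?R = int ` (?U - ?W)" .
  have "card ?E = c * (2 * m - 1) * q"
    unfolding card_cylinder_edges[OF n(3) m] unfolding n(1) by (simp only: ac_simps)
  moreover have "f ` ?V \<subseteq> {0..c * (2 * m - 1) * (q + 1) - 1}"
    using top unfolding MU by fastforce
  moreover have "c * (2 * m - 1) > 0" using pos m by simp
  ultimately have graceful: "divisible_graceful_labeling (c * (2 * m - 1)) ?V ?E f"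
    unfolding divisible_graceful_labeling_def diffs
    using simple_graph_cylinder[OF n(3)] injf pos(2) labels by blast
  \<comment> \<open>For even \<open>n\<close>, reduction modulo \<open>n\<close> preserves parity,
    so the classes of small and large labels are the two colour classes of the grid.\<close>
  define A where "A = {x \<in> ?V. even (fst x + snd x)}"
  define B where "B = {x \<in> ?V. odd (fst x + snd x)}"
  have parity: "even ((i + j) mod n) \<longleftrightarrow> even (i + j)" for i j
    using n(2) by (simp add: dvd_mod_iff)
  have ne: "(1, 1) \<in> A" "(1, 2) \<in> B"
    using n(3) m by (auto simp: A_def B_def cylinder_verts_def)
  have AB: "\<exists>a\<in>A. \<exists>b\<in>B. {x, y} = {a, b}"
    if "x \<in> ?V" "y \<in> ?V" "even (fst x + snd x) \<noteq> even (fst y + snd y)" for x y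
  proof (cases "even (fst x + snd x)")
    case True
    with that have "x \<in> A" "y \<in> B" by (auto simp: A_def B_def)
    then show ?thesis by blast
  next
    case False
    with that have "y \<in> A" "x \<in> B" by (auto simp: A_def B_def)
    then show ?thesis by blast
  qed
  have "\<exists>a\<in>A. \<exists>b\<in>B. e = {a, b}" if "e \<in> ?E" for e
  proof -
    from that obtain i j i' j' where e: "e = {(i, j), (i', j')}" "even (i + j) \<noteq> even (i' + j')"
      unfolding cylinder_edges_def
    proof (elim UnE CollectE exE conjE)
      fix i j assume "e = {(i, j), (i, j mod n + 1)}"
      moreover have "even (i + j) \<noteq> even (i + (j mod n + 1))"
        using n(2) by (simp add: dvd_mod_iff)
      ultimately show ?thesis using that by blast
    next
      fix i j assume "e = {(i, j), (i + 1, j)}"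
      moreover have "even (i + j) \<noteq> even (i + 1 + j)" by simp
      ultimately show ?thesis using that by blast
    qed
    have "e \<subseteq> ?V" using simple_graph_cylinder[OF n(3), of m] that by (auto simp: simple_graph_def)
    then show ?thesis using AB[of "(i, j)" "(i', j')"] e by auto
  qed
  moreover have "A \<noteq> {}" "B \<noteq> {}" "A \<union> B = ?V" "A \<inter> B = {}"
    using ne unfolding A_def B_def by blast+
  ultimately have bip: "bipartition ?V ?E A B"
    unfolding bipartition_def by blast
  have fin: "finite A" "finite B"
    unfolding A_def B_def cylinder_verts_def by simp_all
  have "f x < f y" if "x \<in> A" "y \<in> B" for x y
  proof -
    have "f x < b + M * (m - 1)" using that(1) lowf parity by (auto simp: A_def cylinder_verts_def)
    also have "\<dots> \<le> f y" using that(2) highf parity by (auto simp: B_def cylinder_verts_def)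
    finally show ?thesis .
  qed
  moreover have "Max (f ` A) \<in> f ` A" "Min (f ` B) \<in> f ` B"
    using ne fin by (blast intro: Max_in Min_in)+
  ultimately have "Max (f ` A) < Min (f ` B)" by (elim imageE) simp
  with graceful bip show ?thesis
    unfolding divisible_graceful_alpha_labeling_def f_def M_def by blast
qed

section \<open>The zigzag labeling of the cycle on \<open>4 * k\<close> vertices\<close>

text \<open>A jump applies to all later vertices of the same parity, so it lowers every later
  difference. Jumps by 1 at vertices \<open>k + 1\<close> and \<open>3 * k\<close> skip
  \<open>3 * (k + 1)\<close> and \<open>k + 1\<close>; the parity of \<open>k\<close> decides which
  side each of them moves. The jump by 2 at vertex \<open>2 * k\<close> skips both
  \<open>2 * k + 3\<close> and \<open>2 * (k + 1)\<close>.\<close>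

definition zigzag :: "nat \<Rightarrow> nat \<Rightarrow> nat" where
  "zigzag k p =
     (if even p then p div 2 + (if odd k \<and> k < p then 1 else 0) + (if 2 * k \<le> p then 2 else 0)
        + (if even k \<and> 3 * k \<le> p then 1 else 0)
      else 4 * k + 3 - p div 2 - (if even k \<and> k < p then 1 else 0)
        - (if odd k \<and> 3 * k \<le> p then 1 else 0))"

text \<open>A jump first affects the edge ending at its vertex, hence \<open>Suc p\<close> in the
  conditions; \<open>k \<le> p\<close> stands for the jump at \<open>k + 1\<close>. Which side jumps
  no longer matters, so the parity of \<open>k\<close> disappears.\<close>

lemma zigzag_diff:
  assumes "Suc p < 4 * k"
  shows "\<bar>int (zigzag k p) - int (zigzag k (Suc p))\<bar> = int (4 * k + 3 - p
    - (if k \<le> p then 1 else 0) - (if 2 * k \<le> Suc p then 2 else 0) - (if 3 * k \<le> Suc p then 1 else 0))"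
proof -
  obtain b where k: "k = 2 * b \<or> k = 2 * b + 1" by (metis evenE oddE)
  show ?thesis
  proof (cases "even p")
    case True
    then obtain a where "p = 2 * a" by (elim evenE)
    with assms k show ?thesis
      by (elim disjE; auto simp: zigzag_def; presburger)
  next
    case False
    then obtain a where "p = 2 * a + 1" by (elim oddE)
    with assms k show ?thesis
      by (elim disjE; auto simp: zigzag_def; presburger)
  qed
qed

text \<open>The threshold is exact: the last two vertices, \<open>4 * k - 2\<close> and
  \<open>4 * k - 1\<close>, have labels \<open>2 * k + 2\<close> and
  \<open>2 * k + 3\<close>.\<close>

lemma zigzag_low: "p < 4 * k \<Longrightarrow> even p \<Longrightarrow> zigzag k p < 2 * k + 3"
  unfolding zigzag_def by (auto elim!: evenE oddE)

lemma zigzag_high: "p < 4 * k \<Longrightarrow> odd p \<Longrightarrow> 2 * k + 3 \<le> zigzag k p \<and> zigzag k p < 4 * (k + 1)"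
  unfolding zigzag_def by (auto elim!: evenE oddE)

text \<open>Labels increase along even vertices and decrease along odd ones, the jumps only widening
  the steps; the threshold keeps the two sides apart.\<close>

lemma inj_on_zigzag: "inj_on (zigzag k) {..<4 * k}"
proof (rule linorder_inj_onI)
  fix p p' assume "p < p'" and "p \<in> {..<4 * k}" "p' \<in> {..<4 * k}"
  then have lt: "p < p'" "p < 4 * k" "p' < 4 * k" by auto
  consider "even p" "even p'" | "odd p" "odd p'" | "even p \<noteq> even p'" by blast
  then show "zigzag k p \<noteq> zigzag k p'"
  proof cases
    case 1
    with lt have "zigzag k p < zigzag k p'"
      by (auto simp: zigzag_def elim!: evenE)
    then show ?thesis by simp
  next
    case 2
    with lt have "zigzag k p' < zigzag k p"
      by (auto simp: zigzag_def elim!: oddE)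
    then show ?thesis by simp
  next
    case 3
    then show ?thesis
      using zigzag_low[of p k] zigzag_high[of p k] zigzag_low[of p' k] zigzag_high[of p' k] lt
      by (cases "even p") auto
  qed
qed auto

lemma nonmultiples_below_4:
  fixes k :: nat
  shows "{r. r < 4 * (k + 1) \<and> \<not> k + 1 dvd r}
    = {1..k} \<union> {k + 2..2 * k + 1} \<union> {2 * k + 3..3 * k + 2} \<union> {3 * k + 4..4 * k + 3}" (is "?L = ?R")
proof (intro equalityI subsetI)
  fix r assume r: "r \<in> ?L"
  have "r \<noteq> (k + 1) * t" for t using r dvd_triv_left[of "k + 1" t] by blast
  from this[of 0] this[of 1] this[of 2] this[of 3] r show "r \<in> ?R" by auto
next
  fix r assume r: "r \<in> ?R"
  have "\<not> k + 1 dvd r"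
  proof
    assume "k + 1 dvd r"
    then obtain t where t: "r = (k + 1) * t" by blast
    moreover have "(k + 1) * t < (k + 1) * 4" using r t by auto
    then have "t < 4" by (simp only: mult_less_cancel1)
    then have "t = 0 \<or> t = 1 \<or> t = 2 \<or> t = 3" by auto
    ultimately show False using r by auto
  qed
  with r show "r \<in> ?L" by auto
qed

text \<open>The differences of consecutive vertices descend from \<open>4 * k + 3\<close> to 1,
  missing only the multiples of \<open>k + 1\<close> and \<open>2 * k + 3\<close>, which the edge
  from vertex \<open>4 * k - 1\<close> back to 0 supplies.\<close>

lemma zigzag_diffs:
  assumes "k \<ge> 1"
  shows "(\<lambda>p. \<bar>int (zigzag k p) - int (zigzag k (Suc p mod (4 * k)))\<bar>) ` {..<4 * k}
    = int ` {r. r < 4 * (k + 1) \<and> \<not> k + 1 dvd r}"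
proof -
  define D where "D p = (if Suc p < 4 * k then 4 * k + 3 - p - (if k \<le> p then 1 else 0)
    - (if 2 * k \<le> Suc p then 2 else 0) - (if 3 * k \<le> Suc p then 1 else 0) else 2 * k + 3)" for p
  have "\<bar>int (zigzag k p) - int (zigzag k (Suc p mod (4 * k)))\<bar> = int (D p)" if "p < 4 * k" for p
  proof (cases "Suc p < 4 * k")
    case True
    then show ?thesis using zigzag_diff[OF True] by (simp add: D_def)
  next
    case False
    with that have "Suc p = 4 * k" by simp
    then have p: "p = 2 * (2 * k - 1) + 1" "Suc p mod (4 * k) = 0" by auto
    have "zigzag k p = 2 * k + 3" "zigzag k 0 = 0"
      using assms by (auto simp: zigzag_def p)
    with p False show ?thesis by (simp add: D_def)
  qed
  then have "(\<lambda>p. \<bar>int (zigzag k p) - int (zigzag k (Suc p mod (4 * k)))\<bar>) ` {..<4 * k}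
    = int ` D ` {..<4 * k}"
    by (simp add: image_image)
  also have "D ` {..<4 * k}
    = {1..k} \<union> {k + 2..2 * k + 1} \<union> {2 * k + 3..3 * k + 2} \<union> {3 * k + 4..4 * k + 3}" (is "_ = ?R")
  proof (intro equalityI subsetI)
    fix r assume "r \<in> D ` {..<4 * k}"
    then show "r \<in> ?R" using assms by (auto simp: D_def split: if_splits)
  next
    fix r assume "r \<in> ?R"
    \<comment> \<open>The value of the closing edge is split off. The other witnesses are
      \<open>4 * k + 3 - r\<close> less the number of values skipped above \<open>r\<close>, namely
      4, 3, 1 and 0 in the order of the cases.\<close>
    then consider "r \<in> {1..k}" | "r \<in> {k + 2..2 * k + 1}" | "r = 2 * k + 3"
      | "r \<in> {2 * k + 4..3 * k + 2}" | "r \<in> {3 * k + 4..4 * k + 3}"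
      by force
    then show "r \<in> D ` {..<4 * k}"
    proof cases
      case 1
      then show ?thesis by (intro image_eqI[of _ _ "4 * k - 1 - r"]) (auto simp: D_def)
    next
      case 2
      then show ?thesis by (intro image_eqI[of _ _ "4 * k - r"]) (auto simp: D_def)
    next
      case 3
      then show ?thesis using assms by (intro image_eqI[of _ _ "4 * k - 1"]) (auto simp: D_def)
    next
      case 4
      then show ?thesis by (intro image_eqI[of _ _ "4 * k + 2 - r"]) (auto simp: D_def)
    next
      case 5
      then show ?thesis by (intro image_eqI[of _ _ "4 * k + 3 - r"]) (auto simp: D_def)
    qed
  qed
  finally show ?thesis unfolding nonmultiples_below_4 .
qed

theorem theorem3p4:
  fixes k m :: nat
  assumes "k \<ge> 1" and "m \<ge> 2"
  shows "\<exists>f. divisible_graceful_alpha_labeling (4 * (2 * m - 1))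
               (cylinder_verts (4 * k) m) (cylinder_edges (4 * k) m) f"
proof -
  \<comment> \<open>Propagation with \<open>c = 4\<close>, \<open>q = k\<close> and threshold
    \<open>b = 2 * k + 3\<close>.\<close>
  have "divisible_graceful_alpha_labeling (4 * (2 * m - 1)) (cylinder_verts (4 * k) m)
      (cylinder_edges (4 * k) m) (cylinder_label (zigzag k) (4 * k) (4 * (k + 1)) m)"
    using assms
    by (intro cylinder_divisible_alpha[OF refl _ _ _ inj_on_zigzag zigzag_low zigzag_high zigzag_diffs])
      auto
  then show ?thesis by blast
qed

end
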